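(* Let $a=\alpha_1e_1+\alpha_2e_2+\alpha_3e_3$, $b=\alpha_4e_4+\alpha_5e_5+\alpha_6e_6$. Set $$x=\mathrm{Re}\left(\tfrac12\sqrt{(\alpha_1+\mathbf{i}\alpha_4)^2+(\alpha_2+\mathbf{i}\alpha_5)^2+(\alpha_3+\mathbf{i}\alpha_6)^2}\right),$$ $$y=\mathrm{Im}\left(\tfrac12\sqrt{(\alpha_1+\mathbf{i}\alpha_4)^2+(\alpha_2+\mathbf{i}\alpha_5)^2+(\alpha_3+\mathbf{i}\alpha_6)^2}\right).$$ For non-zero vectors $\vec\alpha=\{\alpha_1,\alpha_2,\alpha_3\}$, $\vec\beta=\{\alpha_4,\alpha_5,\alpha_6\}$ in $\mathbb{R}^3$, $\beta:=|\vec\beta|$, the matrix $\exp(a+b)\exp(-b)$ is Hermitian if and only if one of the following conditions is satisfied: 1) the vectors $\vec\alpha$ and $\vec\beta$ are collinear; 2) $x=\cos(\beta/2)=\cos y=0$; 3) $\cos(\beta/2)\neq 0$, $\cos y\neq 0$ and the triples $x,\,y,\,\beta/2$ and $\tanh x,\,\tan y,\,\tan(\beta/2)$ are proportional; 4) $x=y=0$ and $\tan(\beta/2)=\beta/2$.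
   Context: $e_1=\frac12\begin{pmatrix}0&1\\1&0\end{pmatrix}$, $e_2=\frac12\begin{pmatrix}0&\mathbf{i}\\-\mathbf{i}&0\end{pmatrix}$, $e_3=\frac12\begin{pmatrix}1&0\\0&-1\end{pmatrix}$, $e_4=\mathbf{i}e_1$, $e_5=\mathbf{i}e_2$, $e_6=\mathbf{i}e_3$, where $\mathbf{i}$ is the imaginary unit. The numbers $\alpha_1,\dots,\alpha_6$ are real, $|\cdot|$ is the Euclidean norm in $\mathbb{R}^3$, and $\exp$ is the matrix exponential.
   Formalization: Condition 3 additionally requires that x and y are not both zero; without this the equivalence fails, e.g. for α=(2,0,0), β=(0,2,0), where x=y=0 makes the triples trivially proportional although the matrix is not Hermitian. *)

theory Defs
  imports "HOL-Analysis.Analysis"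
begin

definition e1 :: "complex^2^2" where
  "e1 = (1/2) *\<^sub>R vector [vector [0, 1], vector [1, 0]]"

definition e2 :: "complex^2^2" where
  "e2 = (1/2) *\<^sub>R vector [vector [0, \<i>], vector [- \<i>, 0]]"

definition e3 :: "complex^2^2" where
  "e3 = (1/2) *\<^sub>R vector [vector [1, 0], vector [0, -1]]"

definition e4 :: "complex^2^2" where "e4 = map_matrix ((*) \<i>) e1"

definition e5 :: "complex^2^2" where "e5 = map_matrix ((*) \<i>) e2"

definition e6 :: "complex^2^2" where "e6 = map_matrix ((*) \<i>) e3"

definition hermitian :: "complex^'n^'n \<Rightarrow> bool" where
  "hermitian A \<longleftrightarrow> transpose (map_matrix cnj A) = A"

text \<open>
  The library's multiplication, and hence its power operation, is componentwise on the type of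
  vectors, so the power series of the matrix exponential is built from the matrix product.
\<close>

primrec matpow :: "complex^'n^'n \<Rightarrow> nat \<Rightarrow> complex^'n^'n" where
  "matpow A 0 = mat 1"
| "matpow A (Suc n) = A ** matpow A n"

definition matexp :: "complex^'n^'n \<Rightarrow> complex^'n^'n" where
  "matexp A = (\<Sum>n. (1 / fact n) *\<^sub>R matpow A n)"

lemma norm_matpow_entry:
  "norm (matpow (A :: complex^'n^'n) n $ i $ j) \<le> (real CARD('n) * norm A) ^ n"
proof (induction n arbitrary: i j)
  case 0
  then show ?case by (simp add: mat_def)
next
  case (Suc n)
  let ?R = "(real CARD('n) * norm A) ^ n"
  have e: "norm (A $ i $ k) \<le> norm A" for k
    using Finite_Cartesian_Product.norm_nth_le[of "A $ i" k]
      Finite_Cartesian_Product.norm_nth_le[of A i] by linarith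
  have "norm (matpow A (Suc n) $ i $ j) \<le> (\<Sum>k\<in>UNIV. norm (A $ i $ k * matpow A n $ k $ j))"
    by (simp add: matrix_matrix_mult_def norm_sum)
  also have "\<dots> \<le> (\<Sum>k\<in>(UNIV :: 'n set). norm A * ?R)"
    by (intro sum_mono) (simp only: norm_mult, intro mult_mono e Suc.IH, auto)
  also have "\<dots> = (real CARD('n) * norm A) ^ Suc n"
    by simp
  finally show ?case .
qed

lemma summable_matexp:
  "summable (\<lambda>n. (1 / fact n) *\<^sub>R matpow (A :: complex^'n^'n) n)"
proof (rule summable_comparison_test')
  let ?N = "real CARD('n)"
  have "summable (\<lambda>n. ?N * ?N * (inverse (fact n) * (?N * norm A) ^ n))"
    by (intro summable_mult summable_exp)
  then show "summable (\<lambda>n. ?N * ?N * ((?N * norm A) ^ n / fact n))"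
    by (simp add: field_simps)
  fix n :: nat
  have "norm (matpow A n) \<le> (\<Sum>i\<in>UNIV. norm (matpow A n $ i))"
    unfolding norm_vec_def[of "matpow A n"] by (rule L2_set_le_sum) simp
  also have "\<dots> \<le> (\<Sum>i\<in>(UNIV :: 'n set). \<Sum>j\<in>(UNIV :: 'n set). norm (matpow A n $ i $ j))"
    by (intro sum_mono) (unfold norm_vec_def[where 'a = complex], rule L2_set_le_sum, simp)
  also have "\<dots> \<le> (\<Sum>i\<in>(UNIV :: 'n set). \<Sum>j\<in>(UNIV :: 'n set). (?N * norm A) ^ n)"
    by (intro sum_mono norm_matpow_entry)
  also have "\<dots> = ?N * ?N * (?N * norm A) ^ n"
    by simp
  finally show "norm ((1 / fact n) *\<^sub>R matpow A n) \<le> ?N * ?N * ((?N * norm A) ^ n / fact n)"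
    by (simp add: divide_right_mono)
qed

text \<open>
  A zero vector is proportional to every vector. In particular \<open>(0, 0, s)\<close> and \<open>(0, 0, t)\<close> are
  always proportional, so a proportionality between \<open>(x, y, \<beta>/2)\<close> and
  \<open>(tanh x, tan y, tan (\<beta>/2))\<close> carries no information when \<open>x = y = 0\<close>; the theorem therefore
  restricts it to \<open>(x, y) \<noteq> (0, 0)\<close> and treats \<open>x = y = 0\<close> as a separate case.
\<close>

definition proportional :: "real^'n \<Rightarrow> real^'n \<Rightarrow> bool" where
  "proportional u v \<longleftrightarrow> (\<exists>k. v = k *\<^sub>R u) \<or> (\<exists>k. u = k *\<^sub>R v)"

end

theory Submission
  imports Defs
begin

text \<open>
  Up to the factor 1/2, the matrices \<open>e1\<close>, \<open>e2\<close>, \<open>e3\<close> are Pauli matrices \<open>\<sigma>\<^sub>1\<close>, \<open>\<sigma>\<^sub>2\<close>, \<open>\<sigma>\<^sub>3\<close>, so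
  \<open>a + b = (\<alpha> + \<i>\<beta>) \<cdot> \<sigma> / 2\<close> and \<open>- b = - \<i>\<beta> \<cdot> \<sigma> / 2\<close> for the real vectors \<open>\<alpha>\<close> and \<open>\<beta>\<close>. A traceless
  matrix \<open>M = U \<cdot> \<sigma>\<close> squares to the scalar \<open>U \<cdot> U = z\<^sup>2\<close>, so its exponential is
  \<open>cosh z + (sinh z / z) M\<close> (lemma \<open>matexp_pauli\<close>). With \<open>z = x + \<i>y\<close>, \<open>B = \<bar>\<beta>\<bar>/2\<close>, \<open>C = cosh z\<close>,
  \<open>S = sinh z / z\<close>, \<open>c = cos B\<close> and \<open>s = sin B / B\<close>, the product of the two exponentials is
  \<open>D + V \<cdot> \<sigma>\<close>, where \<open>D\<close> is a scalar and \<open>V\<close> is a complex combination of \<open>\<alpha>\<close>, \<open>\<beta>\<close> and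
  \<open>\<alpha> \<times> \<beta>\<close>. It is Hermitian exactly when \<open>D\<close> and \<open>V\<close> are real.

  If \<open>\<alpha>\<close> and \<open>\<beta>\<close> are collinear, then \<open>a\<close> and \<open>b\<close> commute and the product is \<open>exp a\<close>, which is
  Hermitian (lemma \<open>hermitian_product_collinear\<close>). Otherwise \<open>\<alpha>\<close>, \<open>\<beta>\<close>, \<open>\<alpha> \<times> \<beta>\<close> are linearly
  independent, and reality of \<open>V\<close> splits into \<open>c Im S = 0\<close>, \<open>s Im S = 0\<close> and
  \<open>c Re S = s Re C\<close>. Since \<open>c\<close> and \<open>s\<close> do not both vanish, \<open>S\<close> is real
  (lemma \<open>hermitian_product_noncollinear_iff\<close>).

  What remains is a system in the real numbers \<open>x\<close>, \<open>y\<close>, \<open>B\<close> (lemma \<open>scalar_conditions_iff\<close>). For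
  \<open>z \<noteq> 0\<close> it says that some real \<open>S\<close> satisfies \<open>sinh x cos y = S x\<close>, \<open>cosh x sin y = S y\<close>,
  \<open>c S = s cosh x cos y\<close> and \<open>c sinh x sin y = S s x y\<close>. If \<open>c = 0\<close>, this forces \<open>cos y = 0\<close> and then
  \<open>x = 0\<close>. If \<open>c \<noteq> 0\<close>, it forces \<open>cos y \<noteq> 0\<close>, and dividing by \<open>cosh x cos y\<close> turns it into
  \<open>tanh x = k x\<close>, \<open>tan y = k y\<close> with \<open>k = tan B / B\<close>. For \<open>z = 0\<close> the values are \<open>S = C = 1\<close>, and the
  system becomes \<open>cos B = sin B / B\<close>, that is, \<open>tan B = B\<close>.
\<close>

section \<open>Pauli coordinates\<close>

text \<open>
  The matrix \<open>d + u \<sigma>\<^sub>1 + v \<sigma>\<^sub>2 + w \<sigma>\<^sub>3\<close>, where \<open>\<sigma>\<^sub>2\<close> is the negative of the usual second Pauli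
  matrix, matching \<open>e2\<close>.
\<close>

definition pauli :: "complex \<Rightarrow> complex \<Rightarrow> complex \<Rightarrow> complex \<Rightarrow> complex^2^2" where
  "pauli d u v w = vector [vector [d + w, u + \<i> * v], vector [u - \<i> * v, d - w]]"

lemma pauli_nth [simp]:
  "pauli d u v w $ 1 $ 1 = d + w" "pauli d u v w $ 1 $ 2 = u + \<i> * v"
  "pauli d u v w $ 2 $ 1 = u - \<i> * v" "pauli d u v w $ 2 $ 2 = d - w"
  by (simp_all add: pauli_def)

text \<open>
  In vector notation \<open>(d + U \<cdot> \<sigma>) (d' + U' \<cdot> \<sigma>) = d d' + U \<cdot> U' + (d U' + d' U - \<i> U \<times> U') \<cdot> \<sigma>\<close>. The
  sign of the cross product is opposite to the usual one because of the sign of \<open>\<sigma>\<^sub>2\<close>.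
\<close>

lemma pauli_mult:
  "pauli d u v w ** pauli d' u' v' w' =
     pauli (d * d' + u * u' + v * v' + w * w')
       (d * u' + d' * u - \<i> * (v * w' - w * v'))
       (d * v' + d' * v - \<i> * (w * u' - u * w'))
       (d * w' + d' * w - \<i> * (u * v' - v * u'))"
  by (simp add: vec_eq_iff forall_2 matrix_matrix_mult_def sum_2 algebra_simps)

lemma hermitian_pauli_iff:
  "hermitian (pauli d u v w) \<longleftrightarrow> Im d = 0 \<and> Im u = 0 \<and> Im v = 0 \<and> Im w = 0"
  by (auto simp: hermitian_def vec_eq_iff forall_2 transpose_def map_matrix_def complex_eq_iff)

section \<open>Exponentials of traceless matrices\<close>

lemma Re_cosh: "Re (cosh z) = cosh (Re z) * cos (Im z)"
  and Im_cosh: "Im (cosh z) = sinh (Re z) * sin (Im z)"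
  and Re_sinh: "Re (sinh z) = sinh (Re z) * cos (Im z)"
  and Im_sinh: "Im (sinh z) = cosh (Re z) * sin (Im z)"
  by (simp_all add: cosh_def sinh_def Re_exp Im_exp algebra_simps)

text \<open>
  The entire function \<open>sinh z / z\<close>; the value 1 at the removable singularity makes the
  exponential formula hold for nilpotent matrices too.
\<close>

definition sinhc :: "complex \<Rightarrow> complex" where
  "sinhc z = (if z = 0 then 1 else sinh z / z)"

lemma sinhc_mult_self [simp]: "sinhc z * z = sinh z"
  by (simp add: sinhc_def)

lemma sinhc_sums:
  "(\<lambda>n. (1 / fact n) *\<^sub>R (if odd n then z ^ (n - 1) else 0)) sums sinhc z"
proof (cases "z = 0")
  case True
  have "(1 / fact n) *\<^sub>R (if odd n then z ^ (n - 1) else 0) = (if n = 1 then 1 else 0)" for n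
    by (cases "n = 1"; cases "n = 0") (auto simp: True power_0_left)
  then show ?thesis
    using sums_single[of 1 "\<lambda>_. 1 :: complex"] by (simp only: sinhc_def True simp_thms if_True)
next
  case False
  have "(\<lambda>n. (if even n then 0 else z ^ n /\<^sub>R fact n) / z) sums (sinh z / z)"
    by (intro sums_divide sinh_converges)
  also have "(\<lambda>n. (if even n then 0 else z ^ n /\<^sub>R fact n) / z)
      = (\<lambda>n. (1 / fact n) *\<^sub>R (if odd n then z ^ (n - 1) else 0))"
    using False by (auto simp: fun_eq_iff power_diff odd_pos Suc_leI divide_inverse)
  finally show ?thesis
    using False by (simp add: sinhc_def)
qed

text \<open>
  The square of the matrix is the scalar \<open>z\<^sup>2\<close>, so even powers are scalar and odd powers are
  multiples of the matrix.
\<close>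

lemma matpow_pauli:
  assumes "z\<^sup>2 = u\<^sup>2 + v\<^sup>2 + w\<^sup>2"
  shows "matpow (pauli 0 u v w) n =
    (let p = if even n then z ^ n else 0; q = if odd n then z ^ (n - 1) else 0
     in pauli p (q * u) (q * v) (q * w))"
proof (induction n)
  case 0
  then show ?case
    by (simp add: vec_eq_iff forall_2 mat_def)
next
  case (Suc n)
  show ?case
  proof (cases "even n")
    case True
    then show ?thesis using Suc by (simp add: pauli_mult Let_def mult.commute)
  next
    case False
    then obtain m where m: "n = Suc (2 * m)" by (auto elim: oddE)
    have "u * (z ^ (2 * m) * u) + v * (z ^ (2 * m) * v) + w * (z ^ (2 * m) * w)
        = z ^ (2 * m) * z\<^sup>2"
      unfolding assms by (simp add: algebra_simps power2_eq_square)
    then show ?thesis using Suc m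
      by (simp add: pauli_mult Let_def power2_eq_square algebra_simps)
  qed
qed

lemma sums_componentwise:
  fixes f :: "nat \<Rightarrow> 'a::real_normed_vector ^ 'n ^ 'm"
  assumes "\<And>i j. (\<lambda>n. f n $ i $ j) sums (s $ i $ j)"
  shows "f sums s"
  using assms unfolding sums_def by (intro vec_tendstoI) simp

text \<open>
  The even powers sum to \<open>cosh z\<close>, the odd ones to \<open>sinhc z\<close> times the matrix. Both functions are
  even in \<open>z\<close>, so either square root may serve.
\<close>

lemma matexp_pauli:
  assumes "z\<^sup>2 = u\<^sup>2 + v\<^sup>2 + w\<^sup>2"
  shows "matexp (pauli 0 u v w) = pauli (cosh z) (sinhc z * u) (sinhc z * v) (sinhc z * w)"
proof -
  define p where "p n = (1 / fact n) *\<^sub>R (if even n then z ^ n else 0)" for n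
  define q where "q n = (1 / fact n) *\<^sub>R (if odd n then z ^ (n - 1) else 0)" for n
  have p: "p sums cosh z"
  proof -
    have "p = (\<lambda>n. if even n then z ^ n /\<^sub>R fact n else 0)"
      by (auto simp: p_def divide_inverse)
    then show ?thesis using cosh_converges[of z] by simp
  qed
  have q: "q sums sinhc z"
    unfolding q_def by (rule sinhc_sums)
  have summand: "(1 / fact n) *\<^sub>R matpow (pauli 0 u v w) n
      = pauli (p n) (q n * u) (q n * v) (q n * w)" for n
    unfolding matpow_pauli[OF assms] p_def q_def
    by (simp add: vec_eq_iff forall_2 Let_def algebra_simps)
  have "(\<lambda>n. pauli (p n) (q n * u) (q n * v) (q n * w))
      sums pauli (cosh z) (sinhc z * u) (sinhc z * v) (sinhc z * w)"
  proof (rule sums_componentwise)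
    fix i j :: 2
    have "\<forall>i j. (\<lambda>n. pauli (p n) (q n * u) (q n * v) (q n * w) $ i $ j)
      sums (pauli (cosh z) (sinhc z * u) (sinhc z * v) (sinhc z * w) $ i $ j)"
      unfolding forall_2 pauli_nth
      by (intro conjI sums_add sums_diff sums_mult sums_mult2 p q)
    then show "(\<lambda>n. pauli (p n) (q n * u) (q n * v) (q n * w) $ i $ j)
      sums (pauli (cosh z) (sinhc z * u) (sinhc z * v) (sinhc z * w) $ i $ j)" by blast
  qed
  then show ?thesis
    unfolding matexp_def summand by (rule sums_unique[symmetric])
qed

text \<open>
  Complex multiples of one matrix \<open>N\<close> with \<open>N\<^sup>2 = 1\<close> commute, and their exponentials
  \<open>cosh s + sinh s N\<close> multiply by the addition theorems.
\<close>

lemma matexp_axis_mult: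
  assumes n: "n1\<^sup>2 + n2\<^sup>2 + n3\<^sup>2 = 1"
  shows "matexp (pauli 0 (s * n1) (s * n2) (s * n3)) ** matexp (pauli 0 (t * n1) (t * n2) (t * n3))
       = pauli (cosh (s + t)) (sinh (s + t) * n1) (sinh (s + t) * n2) (sinh (s + t) * n3)"
proof -
  have E: "matexp (pauli 0 (r * n1) (r * n2) (r * n3))
      = pauli (cosh r) (sinh r * n1) (sinh r * n2) (sinh r * n3)" for r
  proof -
    have "r\<^sup>2 = (r * n1)\<^sup>2 + (r * n2)\<^sup>2 + (r * n3)\<^sup>2"
      using n by (simp add: power_mult_distrib flip: distrib_left)
    from matexp_pauli[OF this] show ?thesis
      by (simp flip: mult.assoc)
  qed
  have "cosh s * cosh t + sinh s * n1 * (sinh t * n1) + sinh s * n2 * (sinh t * n2)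
      + sinh s * n3 * (sinh t * n3)
      = cosh s * cosh t + sinh s * sinh t * (n1\<^sup>2 + n2\<^sup>2 + n3\<^sup>2)"
    by (simp add: distrib_left power2_eq_square mult_ac)
  then have scalar: "cosh s * cosh t + sinh s * n1 * (sinh t * n1) + sinh s * n2 * (sinh t * n2)
      + sinh s * n3 * (sinh t * n3) = cosh (s + t)"
    unfolding n cosh_add by simp
  have vector: "cosh s * (sinh t * k) + cosh t * (sinh s * k)
      - \<i> * (sinh s * l * (sinh t * m) - sinh s * m * (sinh t * l)) = sinh (s + t) * k" for k l m
    unfolding sinh_add by (simp add: algebra_simps)
  show ?thesis
    unfolding E pauli_mult scalar vector ..
qed

section \<open>The Hermitian condition\<close>

text \<open>
  Pairing the combination with \<open>u \<times> v\<close> isolates \<open>r\<close>, and then taking its cross product with \<open>v\<close>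
  isolates \<open>p\<close>.
\<close>

lemma lincomb_cross_eq_0_iff:
  fixes u v :: "real^3"
  assumes "cross3 u v \<noteq> 0"
  shows "p *\<^sub>R u + q *\<^sub>R v + r *\<^sub>R cross3 u v = 0 \<longleftrightarrow> p = 0 \<and> q = 0 \<and> r = 0"
proof
  assume eq: "p *\<^sub>R u + q *\<^sub>R v + r *\<^sub>R cross3 u v = 0"
  have "r *\<^sub>R (cross3 u v \<bullet> cross3 u v) = (p *\<^sub>R u + q *\<^sub>R v + r *\<^sub>R cross3 u v) \<bullet> cross3 u v"
    by (simp add: inner_add_left dot_cross_self)
  with eq assms have r: "r = 0" by simp
  have "p *\<^sub>R cross3 u v = cross3 (p *\<^sub>R u + q *\<^sub>R v) v"
    by (simp add: cross_add_left cross_mult_left)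
  with eq r assms have p: "p = 0" by simp
  from assms have "v \<noteq> 0" by auto
  with eq r p show "p = 0 \<and> q = 0 \<and> r = 0" by simp
qed simp

text \<open>
  The case \<open>\<beta> = t \<alpha>\<close>: both exponents lie on the axis of \<open>\<alpha>\<close>, and their imaginary parts cancel in
  the sum, leaving the exponential of the Hermitian matrix \<open>\<alpha> \<cdot> \<sigma> / 2\<close>.
\<close>

lemma hermitian_product_collinear:
  fixes \<alpha>1 \<alpha>2 \<alpha>3 t :: real
  assumes "\<alpha>1 \<noteq> 0 \<or> \<alpha>2 \<noteq> 0 \<or> \<alpha>3 \<noteq> 0"
  defines "\<zeta> \<equiv> (1 + \<i> * t) / 2" and "\<eta> \<equiv> - \<i> * t / 2"
  shows "hermitian (matexp (pauli 0 (\<zeta> * \<alpha>1) (\<zeta> * \<alpha>2) (\<zeta> * \<alpha>3))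
                 ** matexp (pauli 0 (\<eta> * \<alpha>1) (\<eta> * \<alpha>2) (\<eta> * \<alpha>3)))"
proof -
  define r where "r = sqrt (\<alpha>1\<^sup>2 + \<alpha>2\<^sup>2 + \<alpha>3\<^sup>2)"
  have "\<alpha>1\<^sup>2 + \<alpha>2\<^sup>2 + \<alpha>3\<^sup>2 \<noteq> 0"
    using assms(1) by (smt (verit) zero_less_power2 zero_le_power2)
  then have r0: "r \<noteq> 0" and r2: "r\<^sup>2 = \<alpha>1\<^sup>2 + \<alpha>2\<^sup>2 + \<alpha>3\<^sup>2"
    by (simp_all add: r_def)
  have "(\<alpha>1 / r)\<^sup>2 + (\<alpha>2 / r)\<^sup>2 + (\<alpha>3 / r)\<^sup>2 = r\<^sup>2 / r\<^sup>2"
    unfolding power_divide by (simp add: r2 flip: add_divide_distrib)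
  with r0 have "(\<alpha>1 / r)\<^sup>2 + (\<alpha>2 / r)\<^sup>2 + (\<alpha>3 / r)\<^sup>2 = 1" by simp
  from arg_cong[OF this, of complex_of_real] have n: "(complex_of_real (\<alpha>1 / r))\<^sup>2 + (complex_of_real (\<alpha>2 / r))\<^sup>2
      + (complex_of_real (\<alpha>3 / r))\<^sup>2 = 1"
    by (simp only: of_real_add of_real_power of_real_1)
  have scale: "\<xi> * complex_of_real s = (\<xi> * r) * complex_of_real (s / r)" for \<xi> s
    using r0 by simp
  have sum: "\<zeta> * r + \<eta> * r = complex_of_real (r / 2)"
    by (simp add: \<zeta>_def \<eta>_def field_simps)
  show ?thesis
    unfolding scale[of \<zeta> \<alpha>1] scale[of \<zeta> \<alpha>2] scale[of \<zeta> \<alpha>3]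
      scale[of \<eta> \<alpha>1] scale[of \<eta> \<alpha>2] scale[of \<eta> \<alpha>3] matexp_axis_mult[OF n] sum hermitian_pauli_iff
    by (simp add: Im_cosh Im_sinh)
qed

text \<open>
  The factors have the shape of \<open>exp (a + b)\<close> and \<open>exp (- b)\<close>, with \<open>\<alpha>\<close> and \<open>\<beta>\<close> called \<open>u\<close>
  and \<open>v\<close>. Because \<open>(u + \<i>v) \<times> v = u \<times> v\<close>, the imaginary part of the vector coordinates is a
  combination of \<open>u\<close>, \<open>v\<close> and \<open>u \<times> v\<close>, each of whose coefficients must vanish.
\<close>

lemma hermitian_product_noncollinear_iff:
  fixes \<alpha>1 \<alpha>2 \<alpha>3 \<alpha>4 \<alpha>5 \<alpha>6 c s :: real and C S :: complex
  defines "u \<equiv> vector [\<alpha>1, \<alpha>2, \<alpha>3] :: real^3" and "v \<equiv> vector [\<alpha>4, \<alpha>5, \<alpha>6] :: real^3"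
  assumes "cross3 u v \<noteq> 0" and "c \<noteq> 0 \<or> s \<noteq> 0"
  shows "hermitian
      (pauli C (S * ((\<alpha>1 + \<i> * \<alpha>4) / 2)) (S * ((\<alpha>2 + \<i> * \<alpha>5) / 2)) (S * ((\<alpha>3 + \<i> * \<alpha>6) / 2))
    ** pauli c (s * (- \<i> * \<alpha>4 / 2)) (s * (- \<i> * \<alpha>5 / 2)) (s * (- \<i> * \<alpha>6 / 2)))
    \<longleftrightarrow> Im S = 0 \<and> c * Re S = s * Re C \<and> 4 * c * Im C = Re S * s * (u \<bullet> v)"
    (is "hermitian ?P \<longleftrightarrow> _")
proof -
  \<comment> \<open>The imaginary parts of the scalar and of the vector coordinates, cleared of the denominator 4.\<close>
  have "hermitian ?P \<longleftrightarrow>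
      4 * c * Im C + Im S * s * (v \<bullet> v) - Re S * s * (u \<bullet> v) = 0
    \<and> (2 * c * Im S) *\<^sub>R u + (2 * (c * Re S - s * Re C)) *\<^sub>R v + (- s * Im S) *\<^sub>R cross3 u v = 0"
    unfolding pauli_mult hermitian_pauli_iff
    by (simp add: u_def v_def inner_vec_def sum_3 cross3_def vec_eq_iff forall_3) argo
  also have "\<dots> \<longleftrightarrow> Im S = 0 \<and> c * Re S = s * Re C \<and> 4 * c * Im C = Re S * s * (u \<bullet> v)"
    unfolding lincomb_cross_eq_0_iff[OF assms(3)] using assms(4) by auto
  finally show ?thesis .
qed

section \<open>Solving the scalar equations\<close>

text \<open>
  As \<open>B \<noteq> 0\<close>, the first triple is not zero. If it is a multiple of the second triple, the factor is
  therefore not zero and can be inverted, so proportionality always makes the second triple a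
  multiple of the first; the last coordinate determines the factor as \<open>r / B\<close>.
\<close>

lemma proportional_iff_ratio:
  fixes x y B p q r :: real
  assumes "B \<noteq> 0"
  shows "proportional (vector [x, y, B] :: real^3) (vector [p, q, r])
     \<longleftrightarrow> p = r / B * x \<and> q = r / B * y"
proof -
  have "proportional (vector [x, y, B] :: real^3) (vector [p, q, r]) \<longleftrightarrow>
      (\<exists>k. p = k * x \<and> q = k * y \<and> r = k * B) \<or> (\<exists>k. x = k * p \<and> y = k * q \<and> B = k * r)"
    by (simp add: proportional_def vec_eq_iff forall_3)
  moreover have "(\<exists>k. p = k * x \<and> q = k * y \<and> r = k * B) \<longleftrightarrow> p = r / B * x \<and> q = r / B * y"
    using assms by (auto intro!: exI[of _ "r / B"])
  moreover have "p = r / B * x \<and> q = r / B * y" if "x = k * p" "y = k * q" "B = k * r" for k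
    using that assms by auto
  ultimately show ?thesis by blast
qed

lemma sinhc_real_iff:
  fixes x y :: real
  assumes "Complex x y \<noteq> 0"
  shows "sinhc (Complex x y) = complex_of_real S
    \<longleftrightarrow> sinh x * cos y = S * x \<and> cosh x * sin y = S * y"
proof -
  have "sinhc (Complex x y) = complex_of_real S \<longleftrightarrow> sinh (Complex x y) = S * Complex x y"
    using assms by (auto simp: sinhc_def field_simps)
  also have "\<dots> \<longleftrightarrow> sinh x * cos y = S * x \<and> cosh x * sin y = S * y"
    by (simp add: complex_eq_iff Re_sinh Im_sinh)
  finally show ?thesis .
qed

text \<open>
  The second and third equation are \<open>c Re S = s Re C\<close> and \<open>c Im C = Re S s x y\<close>. If
  \<open>cos B \<noteq> 0\<close>, the last one is automatic: after division by \<open>cosh x cos y\<close> it is the product of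
  \<open>tanh x = k x\<close> and \<open>tan y = k y\<close>. The case \<open>z = 0\<close> needs separate treatment because there
  the equation \<open>sinh z = S z\<close> no longer determines \<open>S\<close>.
\<close>

lemma scalar_conditions_iff:
  fixes x y B :: real
  assumes B: "B > 0"
  defines "z \<equiv> Complex x y" and "s \<equiv> sin B / B"
  shows "Im (sinhc z) = 0 \<and> cos B * Re (sinhc z) = s * Re (cosh z)
       \<and> cos B * Im (cosh z) = Re (sinhc z) * s * (x * y)
    \<longleftrightarrow> (x = 0 \<and> cos B = 0 \<and> cos y = 0)
      \<or> (cos B \<noteq> 0 \<and> cos y \<noteq> 0 \<and> (x, y) \<noteq> (0, 0) \<and>
           proportional (vector [x, y, B] :: real^3) (vector [tanh x, tan y, tan B]))
      \<or> (x = 0 \<and> y = 0 \<and> tan B = B)"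
    (is "?L \<longleftrightarrow> ?two \<or> ?three \<or> ?four")
proof (cases "z = 0")
  case True
  then have xy: "x = 0" "y = 0" by (simp_all add: z_def complex_eq_iff)
  have "?L \<longleftrightarrow> cos B = sin B / B"
    by (simp add: xy z_def sinhc_def s_def Complex_eq_0 Re_cosh Im_cosh)
  also have "\<dots> \<longleftrightarrow> tan B = B"
  proof (cases "cos B = 0")
    case True
    then have "sin B \<noteq> 0" using sin_cos_squared_add[of B] by auto
    \<comment> \<open>Here \<open>tan B\<close> takes the default value 0, which differs from \<open>B\<close>.\<close>
    then show ?thesis using True B by (simp add: tan_def)
  next
    case False
    then show ?thesis using B by (auto simp: tan_def field_simps)
  qed
  finally show ?thesis using xy by simp
next
  case False
  then have xy: "x \<noteq> 0 \<or> y \<noteq> 0" by (auto simp: z_def complex_eq_iff)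
  have L: "?L \<longleftrightarrow> (\<exists>S. sinh x * cos y = S * x \<and> cosh x * sin y = S * y
      \<and> cos B * S = s * (cosh x * cos y) \<and> cos B * (sinh x * sin y) = S * s * (x * y))"
    (is "_ \<longleftrightarrow> (\<exists>S. ?M S)")
  proof -
    have "?L \<longleftrightarrow> (\<exists>S. sinhc z = complex_of_real S
      \<and> cos B * S = s * (cosh x * cos y) \<and> cos B * (sinh x * sin y) = S * s * (x * y))"
      by (auto simp: complex_eq_iff Re_cosh Im_cosh z_def)
    then show ?thesis
      using False by (simp add: sinhc_real_iff z_def)
  qed
  show ?thesis
  proof (cases "cos B = 0")
    case True
    then have s0: "s \<noteq> 0" using sin_cos_squared_add[of B] B by (auto simp: s_def)
    have "(\<exists>S. ?M S) \<longleftrightarrow> x = 0 \<and> cos y = 0"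
    proof
      assume "\<exists>S. ?M S"
      then obtain S where S: "?M S" by blast
      with True s0 have c: "cos y = 0" by simp
      then have "sin y \<noteq> 0" using sin_cos_squared_add[of y] by auto
      with S have "S \<noteq> 0" by auto
      with S c show "x = 0 \<and> cos y = 0" by simp
    next
      assume A: "x = 0 \<and> cos y = 0"
      with xy True have "?M (sin y / y)" by simp
      then show "\<exists>S. ?M S" by blast
    qed
    with L True xy show ?thesis by auto
  next
    case cB: False
    have "(\<exists>S. ?M S) \<longleftrightarrow> cos y \<noteq> 0 \<and> tanh x = tan B / B * x \<and> tan y = tan B / B * y"
    proof
      assume "\<exists>S. ?M S"
      then obtain S where S: "?M S" by blast
      then have "cos B * S = s * (cosh x * cos y)" by blast
      then have Sv: "S = tan B / B * (cosh x * cos y)"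
        using cB B by (simp add: s_def tan_def field_simps)
      have cy: "cos y \<noteq> 0"
      proof
        assume "cos y = 0"
        moreover from this S Sv have "sin y = 0" by simp
        ultimately show False using sin_cos_squared_add[of y] by simp
      qed
      have "cosh x * cos y \<noteq> 0" using cy by simp
      then have "tanh x = S / (cosh x * cos y) * x" "tan y = S / (cosh x * cos y) * y"
        using S cy by (auto simp: tanh_def tan_def field_simps)
      moreover have "S / (cosh x * cos y) = tan B / B" using Sv cy by simp
      ultimately show "cos y \<noteq> 0 \<and> tanh x = tan B / B * x \<and> tan y = tan B / B * y"
        using cy by simp
    next
      assume A: "cos y \<noteq> 0 \<and> tanh x = tan B / B * x \<and> tan y = tan B / B * y"
      define k where "k = tan B / B"
      have s: "s = cos B * k" using cB by (simp add: s_def k_def tan_def)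
      have k: "tanh x = k * x" "tan y = k * y" and cy: "cos y \<noteq> 0"
        using A unfolding k_def by blast+
      have 1: "sinh x = k * x * cosh x" "sin y = k * y * cos y"
        unfolding k[symmetric] using cy by (simp_all add: tanh_def tan_def)
      have "?M (k * (cosh x * cos y))"
        unfolding s 1 by (simp add: algebra_simps)
      then show "\<exists>S. ?M S" by blast
    qed
    then show ?thesis
      using L cB xy B by (auto simp: proportional_iff_ratio)
  qed
qed

theorem proposition12:
  fixes \<alpha>1 \<alpha>2 \<alpha>3 \<alpha>4 \<alpha>5 \<alpha>6 x y \<beta> :: real
    and a b :: "complex^2^2"
    and \<alpha>vec \<beta>vec :: "real^3"
  assumes "a = \<alpha>1 *\<^sub>R e1 + \<alpha>2 *\<^sub>R e2 + \<alpha>3 *\<^sub>R e3"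
    and "b = \<alpha>4 *\<^sub>R e4 + \<alpha>5 *\<^sub>R e5 + \<alpha>6 *\<^sub>R e6"
    and "x = Re (1/2 * csqrt ((complex_of_real \<alpha>1 + \<i> * complex_of_real \<alpha>4)^2
               + (complex_of_real \<alpha>2 + \<i> * complex_of_real \<alpha>5)^2
               + (complex_of_real \<alpha>3 + \<i> * complex_of_real \<alpha>6)^2))"
    and "y = Im (1/2 * csqrt ((complex_of_real \<alpha>1 + \<i> * complex_of_real \<alpha>4)^2
               + (complex_of_real \<alpha>2 + \<i> * complex_of_real \<alpha>5)^2
               + (complex_of_real \<alpha>3 + \<i> * complex_of_real \<alpha>6)^2))"
    and "\<alpha>vec = vector [\<alpha>1, \<alpha>2, \<alpha>3]"
    and "\<beta>vec = vector [\<alpha>4, \<alpha>5, \<alpha>6]"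
    and "\<alpha>vec \<noteq> 0"
    and "\<beta>vec \<noteq> 0"
    and "\<beta> = norm \<beta>vec"
  shows "hermitian (matexp (a + b) ** matexp (- b)) \<longleftrightarrow>
           collinear {0, \<alpha>vec, \<beta>vec}
         \<or> (x = 0 \<and> cos (\<beta>/2) = 0 \<and> cos y = 0)
         \<or> (cos (\<beta>/2) \<noteq> 0 \<and> cos y \<noteq> 0 \<and> (x, y) \<noteq> (0, 0) \<and>
             proportional (vector [x, y, \<beta>/2] :: real^3) (vector [tanh x, tan y, tan (\<beta>/2)]))
         \<or> (x = 0 \<and> y = 0 \<and> tan (\<beta>/2) = \<beta>/2)"
proof -
  have ab: "a + b = pauli 0 ((\<alpha>1 + \<i> * \<alpha>4) / 2) ((\<alpha>2 + \<i> * \<alpha>5) / 2) ((\<alpha>3 + \<i> * \<alpha>6) / 2)"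
    and mb: "- b = pauli 0 (- \<i> * \<alpha>4 / 2) (- \<i> * \<alpha>5 / 2) (- \<i> * \<alpha>6 / 2)"
    unfolding assms(1,2)
    by (simp_all add: vec_eq_iff forall_2 e1_def e2_def e3_def e4_def e5_def e6_def
        map_matrix_def complex_eq_iff)
  show ?thesis
  proof (cases "collinear {0, \<alpha>vec, \<beta>vec}")
    case True
    then obtain t where t: "\<beta>vec = t *\<^sub>R \<alpha>vec"
      using assms(7,8) by (auto simp: collinear_lemma)
    then have "\<alpha>4 = t * \<alpha>1" "\<alpha>5 = t * \<alpha>2" "\<alpha>6 = t * \<alpha>3"
      unfolding assms(5,6) by (simp_all add: vec_eq_iff forall_3)
    then have "a + b = pauli 0 ((1 + \<i> * t) / 2 * \<alpha>1) ((1 + \<i> * t) / 2 * \<alpha>2) ((1 + \<i> * t) / 2 * \<alpha>3)"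
      and "- b = pauli 0 (- \<i> * t / 2 * \<alpha>1) (- \<i> * t / 2 * \<alpha>2) (- \<i> * t / 2 * \<alpha>3)"
      unfolding ab mb by (simp_all add: algebra_simps)
    moreover have "\<alpha>1 \<noteq> 0 \<or> \<alpha>2 \<noteq> 0 \<or> \<alpha>3 \<noteq> 0"
      using assms(7) unfolding assms(5) by (auto simp: vec_eq_iff forall_3)
    ultimately show ?thesis
      using True hermitian_product_collinear[of \<alpha>1 \<alpha>2 \<alpha>3 t] by simp
  next
    case False
    define w where "w = (\<alpha>1 + \<i> * \<alpha>4)\<^sup>2 + (\<alpha>2 + \<i> * \<alpha>5)\<^sup>2 + (\<alpha>3 + \<i> * \<alpha>6)\<^sup>2"
    define B where "B = \<beta> / 2"
    define s where "s = sin B / B"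
    define z where "z = Complex x y"
    have B: "B > 0" using assms(8,9) by (simp add: B_def)
    have "z = csqrt w / 2"
      unfolding z_def assms(3,4) w_def by (simp add: complex_eq_iff)
    then have z2: "z\<^sup>2 = w / 4"
      by (simp only: power_divide power2_csqrt) simp
    \<comment> \<open>Compare the imaginary parts of \<open>4 z\<^sup>2 = (\<alpha> + \<i>\<beta>) \<cdot> (\<alpha> + \<i>\<beta>)\<close>.\<close>
    have dot: "\<alpha>vec \<bullet> \<beta>vec = 4 * (x * y)"
    proof -
      have "Im (z\<^sup>2) = 2 * (x * y)" by (simp add: z_def power2_eq_square)
      moreover have "Im (w / 4) = (\<alpha>vec \<bullet> \<beta>vec) / 2"
        unfolding assms(5,6) w_def
        by (simp add: inner_vec_def sum_3 power2_eq_square)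
      ultimately show ?thesis using z2 by simp
    qed
    have Mab: "matexp (a + b) = pauli (cosh z) (sinhc z * ((\<alpha>1 + \<i> * \<alpha>4) / 2))
        (sinhc z * ((\<alpha>2 + \<i> * \<alpha>5) / 2)) (sinhc z * ((\<alpha>3 + \<i> * \<alpha>6) / 2))"
      unfolding ab
      by (rule matexp_pauli) (simp add: z2 w_def power_divide flip: add_divide_distrib)
    have Mb: "matexp (- b) = pauli (cos B) (s * (- \<i> * \<alpha>4 / 2))
        (s * (- \<i> * \<alpha>5 / 2)) (s * (- \<i> * \<alpha>6 / 2))"
    proof -
      have "\<beta>\<^sup>2 = \<alpha>4\<^sup>2 + \<alpha>5\<^sup>2 + \<alpha>6\<^sup>2"
        unfolding assms(9,6) power2_norm_eq_inner
        by (simp add: inner_vec_def sum_3 power2_eq_square)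
      from arg_cong[OF this, of complex_of_real] have "(complex_of_real \<beta>)\<^sup>2 = (complex_of_real \<alpha>4)\<^sup>2 + (complex_of_real \<alpha>5)\<^sup>2
          + (complex_of_real \<alpha>6)\<^sup>2"
        by (simp only: of_real_add of_real_power)
      \<comment> \<open>The root \<open>\<i> B\<close> turns the hyperbolic functions into trigonometric ones.\<close>
      then have "(\<i> * B)\<^sup>2 = (- \<i> * \<alpha>4 / 2)\<^sup>2 + (- \<i> * \<alpha>5 / 2)\<^sup>2 + (- \<i> * \<alpha>6 / 2)\<^sup>2"
        by (simp add: B_def power_divide power_mult_distrib add_divide_distrib)
      moreover have "cosh (\<i> * B) = complex_of_real (cos B)"
        by (simp add: complex_eq_iff Re_cosh Im_cosh)
      moreover have "sinhc (\<i> * B) = complex_of_real s"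
        using B by (simp add: sinhc_def s_def complex_eq_iff Re_sinh Im_sinh
            Re_divide Im_divide power2_eq_square)
      ultimately show ?thesis
        unfolding mb by (simp only: matexp_pauli)
    qed
    have cross: "cross3 \<alpha>vec \<beta>vec \<noteq> 0"
      using False by (simp add: cross_eq_0)
    have "cos B \<noteq> 0 \<or> s \<noteq> 0"
      using B sin_zero_abs_cos_one[of B] by (auto simp: s_def)
    from hermitian_product_noncollinear_iff[OF cross[unfolded assms(5,6)] this,
        of "cosh z" "sinhc z", folded Mab Mb assms(5,6)]
    have "hermitian (matexp (a + b) ** matexp (- b)) \<longleftrightarrow>
        Im (sinhc z) = 0 \<and> cos B * Re (sinhc z) = s * Re (cosh z)
        \<and> cos B * Im (cosh z) = Re (sinhc z) * s * (x * y)"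
      unfolding dot by (simp add: mult.assoc)
    from this[unfolded scalar_conditions_iff[OF B, of x y, folded z_def s_def], unfolded B_def]
    show ?thesis
      using False by simp
  qed
qed

end
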